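(* Let $f_1,\dots,f_r\in\mathbb{C}[Z_1,\dots,Z_n]$, $I=\langle f_1,\dots,f_r\rangle$, and let $\lambda=(\lambda_1,\dots,\lambda_n)\in(0,\infty)^n$. Let $I'\subset\mathbb{R}[X,Y]$ be the ideal generated by $$\{f_j^{\mathrm{re}},\,f_j^{\mathrm{im}} : 1\le j\le r\}\ \cup\ \{X_k^2+Y_k^2-\lambda_k^2 : 1\le k\le n\}.$$ Either $\lambda\in\mathcal{U}_I$, or there exist a polynomial $G\in I'$ and a sum of squares polynomial $H\in\mathbb{R}[X,Y]$ with $$G+H+1=0 .$$
   Context: $\mathbb{R}[X,Y]=\mathbb{R}[X_1,\dots,X_n,Y_1,\dots,Y_n]$. For $f\in\mathbb{C}[Z_1,\dots,Z_n]$, the polynomials $f^{\mathrm{re}},f^{\mathrm{im}}\in\mathbb{R}[X,Y]$ are its real and imaginary parts, defined by $f(X+iY)=f^{\mathrm{re}}(X,Y)+i\,f^{\mathrm{im}}(X,Y)$, where $Z_k=X_k+iY_k$. $\mathcal{V}(I)\subset\mathbb{C}^n$ is the complex variety of $I$, and the unlog amoeba of $I$ is $\mathcal{U}_I=\{(|z_1|,\dots,|z_n|) : z\in\mathcal{V}(I)\}$. A sum of squares polynomial is a finite sum of squares of polynomials in $\mathbb{R}[X,Y]$. *)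

theory Defs
  imports "HOL-Analysis.Analysis" "HOL-Library.Poly_Mapping"
begin

text \<open>
  A monomial is a finitely supported exponent function on the variables, a polynomial is a
  finitely supported coefficient function on monomials; its ring structure is the convolution
  product of \<^theory>\<open>HOL-Library.Poly_Mapping\<close>.
  The ring \<open>\<complex>[Z\<^sub>1,\<dots>,Z\<^sub>n]\<close> is \<open>('n, complex) mpoly\<close> with \<open>n = CARD('n)\<close>, and
  \<open>\<real>[X,Y]\<close> is \<open>('n + 'n, real) mpoly\<close>: \<open>Inl k\<close> indexes \<open>X\<^sub>k\<close> and \<open>Inr k\<close> indexes \<open>Y\<^sub>k\<close>.
\<close>

type_synonym ('v, 'a) mpoly = "('v \<Rightarrow>\<^sub>0 nat) \<Rightarrow>\<^sub>0 'a"

definition Const :: "'a::zero \<Rightarrow> ('v, 'a) mpoly" where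
  "Const c = Poly_Mapping.single 0 c"

definition Var :: "'v \<Rightarrow> ('v, 'a::zero_neq_one) mpoly" where
  "Var v = Poly_Mapping.single (Poly_Mapping.single v 1) 1"

text \<open>Substitution of \<open>x v\<close> for each variable \<open>v\<close>, with the coefficients mapped along \<open>h\<close>.\<close>

definition subst :: "('a \<Rightarrow> 'b) \<Rightarrow> ('v \<Rightarrow> 'b) \<Rightarrow> ('v, 'a::zero) mpoly \<Rightarrow> 'b::comm_semiring_1" where
  "subst h x p = (\<Sum>m\<in>Poly_Mapping.keys p.
     h (Poly_Mapping.lookup p m) *
     (\<Prod>v\<in>Poly_Mapping.keys m. x v ^ Poly_Mapping.lookup m v))"

definition eval :: "('v, 'a) mpoly \<Rightarrow> ('v \<Rightarrow> 'a) \<Rightarrow> 'a::comm_semiring_1" where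
  "eval p x = subst (\<lambda>c. c) x p"

text \<open>The polynomial \<open>f(X + iY)\<close> in \<open>\<complex>[X,Y]\<close>.\<close>

definition XiY :: "('n, complex) mpoly \<Rightarrow> ('n + 'n, complex) mpoly" where
  "XiY f = subst Const (\<lambda>k. Var (Inl k) + Const \<i> * Var (Inr k)) f"

definition re_part :: "('n, complex) mpoly \<Rightarrow> ('n + 'n, real) mpoly" where
  "re_part f = Poly_Mapping.map Re (XiY f)"

definition im_part :: "('n, complex) mpoly \<Rightarrow> ('n + 'n, real) mpoly" where
  "im_part f = Poly_Mapping.map Im (XiY f)"

lemma XiY_eq:
  "XiY f = Poly_Mapping.map complex_of_real (re_part f)
         + Const \<i> * Poly_Mapping.map complex_of_real (im_part f)"
  by (rule poly_mapping_eqI)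
    (simp add: Const_def re_part_def im_part_def lookup_add map.rep_eq when_def complex_eq_iff
      flip: mult_map_scale_conv_mult)

text \<open>For a commutative ring regarded as a module over itself, the span of a set is the ideal
  that it generates.\<close>

global_interpretation ideal: module "(*) :: 'a::comm_ring_1 \<Rightarrow> 'a \<Rightarrow> 'a"
  by unfold_locales (simp_all add: algebra_simps)

definition complex_variety :: "('n::finite, complex) mpoly set \<Rightarrow> (complex ^ 'n) set" where
  "complex_variety I = {z. \<forall>f\<in>I. eval f (\<lambda>k. z $ k) = 0}"

definition unlog_amoeba :: "('n::finite, complex) mpoly set \<Rightarrow> (real ^ 'n) set" where
  "unlog_amoeba I = (\<lambda>z. \<chi> k. cmod (z $ k)) ` complex_variety I"

definition sum_of_squares :: "'a::comm_semiring_1 \<Rightarrow> bool" where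
  "sum_of_squares H \<longleftrightarrow> (\<exists>(N::nat) h. H = (\<Sum>j<N. h j ^ 2))"

end

theory Submission
  imports Defs
begin

text \<open>
  If \<open>-1\<close> is not in the quadratic module \<open>I' + \<Sigma>\<real>[X,Y]\<^sup>2\<close>, enlarge it to a maximal proper
  quadratic module \<open>M\<close>; then \<open>M \<union> -M\<close> is the whole ring. The generators
  \<open>X\<^sub>k\<^sup>2 + Y\<^sub>k\<^sup>2 - \<lambda>\<^sub>k\<^sup>2\<close> make \<open>M\<close> Archimedean, so every polynomial differs from a real number by
  an element that is infinitesimal with respect to \<open>M\<close>. The infinitesimal elements form an ideal
  containing \<open>I'\<close>, hence these real numbers for the variables are the coordinates of a real zero of
  \<open>I'\<close>, that is, of a point of \<open>\<V>(I)\<close> over \<open>\<lambda>\<close>.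
\<close>

text \<open>As a simplification rule, \<open>a * (b * x) = (a * b) * x\<close> loops with the AC rules for
  multiplication.\<close>

declare ideal.scale_scale [simp del]

section \<open>Sums of squares and quadratic modules\<close>

lemma sum_of_squares_0: "sum_of_squares (0 :: 'a::comm_semiring_1)"
  unfolding sum_of_squares_def by (rule exI[of _ 0]) simp

lemma sum_of_squares_power2: "sum_of_squares (b ^ 2 :: 'a::comm_semiring_1)"
  unfolding sum_of_squares_def by (rule exI[of _ 1], rule exI[of _ "\<lambda>_. b"]) simp

lemma sum_of_squares_add:
  fixes a b :: "'a::comm_semiring_1"
  assumes "sum_of_squares a" "sum_of_squares b"
  shows "sum_of_squares (a + b)"
proof -
  obtain N :: nat and g where a: "a = (\<Sum>j<N. g j ^ 2)"
    using assms(1) unfolding sum_of_squares_def by blast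
  obtain K :: nat and h where b: "b = (\<Sum>j<K. h j ^ 2)"
    using assms(2) unfolding sum_of_squares_def by blast
  \<comment> \<open>The two families are concatenated, the second shifted by \<open>N\<close>;
    leaving its length \<open>k\<close> free allows induction on the tail.\<close>
  let ?u = "\<lambda>j. if j < N then g j else h (j - N)"
  have "(\<Sum>j<N + k. ?u j ^ 2) = (\<Sum>j<N. g j ^ 2) + (\<Sum>j<k. h j ^ 2)" for k
    by (induction k) (auto simp: add.assoc)
  then show ?thesis
    unfolding sum_of_squares_def a b by metis
qed

lemma sum_of_squares_mult_power2:
  fixes a b :: "'a::comm_semiring_1"
  assumes "sum_of_squares a"
  shows "sum_of_squares (b ^ 2 * a)"
proof -
  obtain N :: nat and g where a: "a = (\<Sum>j<N. g j ^ 2)"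
    using assms unfolding sum_of_squares_def by blast
  have "b ^ 2 * a = (\<Sum>j<N. (b * g j) ^ 2)"
    by (simp add: a sum_distrib_left power_mult_distrib)
  then show ?thesis
    unfolding sum_of_squares_def by (intro exI)
qed

definition quadratic_module :: "'a::comm_ring_1 set \<Rightarrow> bool" where
  "quadratic_module M \<longleftrightarrow>
    1 \<in> M \<and> (\<forall>a\<in>M. \<forall>b\<in>M. a + b \<in> M) \<and> (\<forall>a\<in>M. \<forall>b. b ^ 2 * a \<in> M)"

lemma quadratic_module_add: "quadratic_module M \<Longrightarrow> a \<in> M \<Longrightarrow> b \<in> M \<Longrightarrow> a + b \<in> M"
  by (simp add: quadratic_module_def)

lemma quadratic_module_mult_power2: "quadratic_module M \<Longrightarrow> a \<in> M \<Longrightarrow> b ^ 2 * a \<in> M"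
  by (simp add: quadratic_module_def)

lemma quadratic_module_power2: "quadratic_module M \<Longrightarrow> b ^ 2 \<in> M"
  using quadratic_module_mult_power2[of M 1 b] by (simp add: quadratic_module_def)

lemma quadratic_module_0: "quadratic_module M \<Longrightarrow> 0 \<in> M"
  using quadratic_module_power2[of M 0] by simp

lemma quadratic_module_mult_sum_of_squares:
  assumes M: "quadratic_module M" and "sum_of_squares s" "a \<in> M"
  shows "s * a \<in> M"
proof -
  obtain N :: nat and h where s: "s = (\<Sum>j<N. h j ^ 2)"
    using assms(2) unfolding sum_of_squares_def by blast
  have "(\<Sum>j<k. h j ^ 2) * a \<in> M" for k
    by (induction k)
      (auto simp: distrib_right M assms(3) quadratic_module_0 quadratic_module_add
        quadratic_module_mult_power2)
  then show ?thesis
    by (simp add: s)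
qed

lemma quadratic_module_sum_of_squares:
  "quadratic_module M \<Longrightarrow> sum_of_squares s \<Longrightarrow> s \<in> M"
  using quadratic_module_mult_sum_of_squares[of M s 1] by (simp add: quadratic_module_def)

text \<open>The starting point for Zorn's lemma: a certificate \<open>G + H + 1 = 0\<close> exists
  exactly when -1 lies in this module.\<close>

lemma quadratic_module_ideal_plus_squares:
  "quadratic_module {g + h |g h. g \<in> ideal.span S \<and> sum_of_squares h}"
  unfolding quadratic_module_def
proof (intro conjI ballI allI)
  show "1 \<in> {g + h |g h. g \<in> ideal.span S \<and> sum_of_squares h}"
    using ideal.span_zero[of S] sum_of_squares_power2[of "1 :: 'a"] by force
next
  fix a b assume "a \<in> {g + h |g h. g \<in> ideal.span S \<and> sum_of_squares h}"
    and "b \<in> {g + h |g h. g \<in> ideal.span S \<and> sum_of_squares h}"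
  then obtain g h g' h' where "g \<in> ideal.span S" "sum_of_squares h" "a = g + h"
    and "g' \<in> ideal.span S" "sum_of_squares h'" "b = g' + h'" by blast
  moreover from this have "a + b = (g + g') + (h + h')" by simp
  ultimately show "a + b \<in> {g + h |g h. g \<in> ideal.span S \<and> sum_of_squares h}"
    using ideal.span_add sum_of_squares_add by blast
next
  fix a b assume "a \<in> {g + h |g h. g \<in> ideal.span S \<and> sum_of_squares h}"
  then obtain g h where "g \<in> ideal.span S" "sum_of_squares h" "a = g + h" by blast
  moreover from this have "b ^ 2 * a = b ^ 2 * g + b ^ 2 * h" by (simp add: distrib_left)
  ultimately show "b ^ 2 * a \<in> {g + h |g h. g \<in> ideal.span S \<and> sum_of_squares h}"
    using ideal.span_scale sum_of_squares_mult_power2 by blast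
qed

text \<open>This is the module generated by \<open>M\<close> and \<open>a\<close>, against which
  maximality is tested. Only sums of squares multiply \<open>a\<close>, since a quadratic module
  need not be closed under products.\<close>

lemma quadratic_module_adjoin:
  assumes M: "quadratic_module M"
  shows "quadratic_module {s + a * t |s t. s \<in> M \<and> sum_of_squares t}"
  unfolding quadratic_module_def
proof (intro conjI ballI allI)
  show "1 \<in> {s + a * t |s t. s \<in> M \<and> sum_of_squares t}"
    using M sum_of_squares_0 unfolding quadratic_module_def by force
next
  fix x y assume "x \<in> {s + a * t |s t. s \<in> M \<and> sum_of_squares t}"
    and "y \<in> {s + a * t |s t. s \<in> M \<and> sum_of_squares t}"
  then obtain s t s' t' where "s \<in> M" "sum_of_squares t" "x = s + a * t"
    and "s' \<in> M" "sum_of_squares t'" "y = s' + a * t'" by blast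
  moreover from this have "x + y = (s + s') + a * (t + t')" by (simp add: algebra_simps)
  ultimately show "x + y \<in> {s + a * t |s t. s \<in> M \<and> sum_of_squares t}"
    using quadratic_module_add[OF M] sum_of_squares_add by blast
next
  fix x b assume "x \<in> {s + a * t |s t. s \<in> M \<and> sum_of_squares t}"
  then obtain s t where "s \<in> M" "sum_of_squares t" "x = s + a * t" by blast
  moreover from this have "b ^ 2 * x = b ^ 2 * s + a * (b ^ 2 * t)"
    by (simp add: distrib_left mult.left_commute)
  ultimately show "b ^ 2 * x \<in> {s + a * t |s t. s \<in> M \<and> sum_of_squares t}"
    using quadratic_module_mult_power2[OF M] sum_of_squares_mult_power2 by blast
qed

text \<open>Zorn's lemma applies because the union of a nonempty chain is an upper bound: two of its
  elements lie in a common member, and no member contains -1.\<close>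

lemma maximal_quadratic_module_exists:
  assumes "quadratic_module M\<^sub>0" and "-1 \<notin> M\<^sub>0"
  obtains M where "M\<^sub>0 \<subseteq> M" "quadratic_module M" "-1 \<notin> M"
    and "\<And>M'. quadratic_module M' \<Longrightarrow> -1 \<notin> M' \<Longrightarrow> M \<subseteq> M' \<Longrightarrow> M' = M"
proof -
  let ?A = "{M. M\<^sub>0 \<subseteq> M \<and> quadratic_module M \<and> -1 \<notin> M}"
  have "\<exists>M\<in>?A. \<forall>X\<in>?A. M \<subseteq> X \<longrightarrow> X = M"
  proof (rule subset_Zorn_nonempty)
    show "?A \<noteq> {}"
      using assms by blast
  next
    fix C assume C: "C \<noteq> {}" "subset.chain ?A C"
    have "a + b \<in> \<Union>C" if ab: "a \<in> \<Union>C" "b \<in> \<Union>C" for a b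
    proof -
      obtain K L where "a \<in> K" "b \<in> L" "K \<in> C" "L \<in> C"
        using ab by blast
      moreover from this have "K \<subseteq> L \<or> L \<subseteq> K"
        using C(2) unfolding subset_chain_def by blast
      moreover have "quadratic_module K" "quadratic_module L"
        using \<open>K \<in> C\<close> \<open>L \<in> C\<close> C(2) unfolding subset_chain_def by auto
      ultimately show ?thesis
        using quadratic_module_add by blast
    qed
    moreover have C': "M\<^sub>0 \<subseteq> K" "quadratic_module K" "-1 \<notin> K" if "K \<in> C" for K
      using C(2) that unfolding subset_chain_def by auto
    moreover have "1 \<in> \<Union>C"
      using C(1) C'(2) by (auto simp: quadratic_module_def)
    moreover have "b ^ 2 * a \<in> \<Union>C" if "a \<in> \<Union>C" for a b
      using that C'(2) quadratic_module_mult_power2 by blast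
    moreover have "M\<^sub>0 \<subseteq> \<Union>C"
      using C(1) C'(1) by blast
    ultimately show "\<Union>C \<in> ?A"
      unfolding quadratic_module_def by auto
  qed
  then obtain M where "M \<in> ?A" and max: "\<forall>X\<in>?A. M \<subseteq> X \<longrightarrow> X = M"
    by blast
  then show thesis
    by (intro that[of M]) auto
qed

section \<open>Algebras over the reals\<close>

text \<open>\<open>c\<close> is a ring homomorphism from the reals, that is, an algebra structure on
  the target ring; for real polynomials it is \<open>Const\<close>.\<close>

locale real_coefficients =
  fixes c :: "real \<Rightarrow> 'a::comm_ring_1"
  assumes add: "c (r + s) = c r + c s"
    and mult: "c (r * s) = c r * c s"
    and one: "c 1 = 1"
begin

lemma zero: "c 0 = 0"
  using add[of 0 0] by simp

lemma minus: "c (- r) = - c r"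
  using add[of r "- r"] zero by (simp add: eq_neg_iff_add_eq_0 add.commute)

lemma diff: "c (r - s) = c r - c s"
  using add[of r "- s"] minus by simp

text \<open>A nonnegative real is the square of a real, hence its image is a square in the
  ring.\<close>

lemma nonneg_in_quadratic_module:
  assumes "quadratic_module M" "0 \<le> r"
  shows "c r \<in> M"
proof -
  have "c r = c (sqrt r) ^ 2"
    using mult[of "sqrt r" "sqrt r"] assms(2) by (simp add: power2_eq_square)
  then show ?thesis
    using quadratic_module_power2[OF assms(1)] by simp
qed

lemma mult_nonneg_in_quadratic_module:
  assumes "quadratic_module M" "0 \<le> r" "a \<in> M"
  shows "c r * a \<in> M"
proof -
  have "c r = c (sqrt r) ^ 2"
    using mult[of "sqrt r" "sqrt r"] assms(2) by (simp add: power2_eq_square)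
  then show ?thesis
    using quadratic_module_mult_power2[OF assms(1,3)] by simp
qed

text \<open>A quadratic module absorbs only squares. Writing \<open>a\<close> as ((a+1)/2)^2 -
  ((a-1)/2)^2 gives access to multiplication by arbitrary elements, once both signs of
  \<open>b\<close> are under control.\<close>

lemma polarize: "a * b = c (1/2) ^ 2 * ((a + 1) ^ 2 * b) - c (1/2) ^ 2 * ((a - 1) ^ 2 * b)"
proof -
  have h: "c (1/2) + c (1/2) = 1"
    using add[of "1/2" "1/2"] one by simp
  have "c (1/2) ^ 2 * ((a + 1) ^ 2 * b) - c (1/2) ^ 2 * ((a - 1) ^ 2 * b)
      = (c (1/2) + c (1/2)) * (c (1/2) + c (1/2)) * (a * b)"
    by (simp add: algebra_simps power2_eq_square)
  then show ?thesis
    by (simp add: h)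
qed

text \<open>In a maximal proper quadratic module, failure of both \<open>a \<in> M\<close> and \<open>-a \<in> M\<close> writes
  \<open>-1\<close> as \<open>s + a t\<close> and as \<open>s' - a t'\<close>. Eliminating \<open>a\<close> puts \<open>t\<close> into the
  ideal \<open>M \<inter> -M\<close>, whence \<open>-1 \<in> M\<close>.\<close>

lemma maximal_quadratic_module_total:
  fixes M :: "'a set"
  assumes M: "quadratic_module M" "-1 \<notin> M"
    and max: "\<And>M'. quadratic_module M' \<Longrightarrow> -1 \<notin> M' \<Longrightarrow> M \<subseteq> M' \<Longrightarrow> M' = M"
  shows "a \<in> M \<or> - a \<in> M"
proof (rule ccontr)
  assume a: "\<not> (a \<in> M \<or> - a \<in> M)"
  \<comment> \<open>Adjoining \<open>b\<close> enlarges \<open>M\<close> strictly, so by maximality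
    the larger module contains -1.\<close>
  have ex: "\<exists>s t. s \<in> M \<and> sum_of_squares t \<and> -1 = s + b * t" if b: "b \<notin> M" for b
  proof -
    let ?M = "{s + b * t |s t. s \<in> M \<and> sum_of_squares t}"
    have "M \<subseteq> ?M"
      using sum_of_squares_0 by force
    moreover have "b \<in> ?M"
      by (intro CollectI exI[of _ 0] exI[of _ "1 ^ 2"])
        (simp add: quadratic_module_0[OF M(1)] sum_of_squares_power2[of 1, simplified])
    ultimately have "?M \<noteq> M"
      using b by metis
    then have "-1 \<in> ?M"
      using max[OF quadratic_module_adjoin[OF M(1), of b]] \<open>M \<subseteq> ?M\<close> by metis
    then show ?thesis
      by (simp only: mem_Collect_eq) metis
  qed
  obtain s t where s: "s \<in> M" and t: "sum_of_squares t" and st: "-1 = s + a * t"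
    using ex[of a] a by blast
  obtain s' t' where s': "s' \<in> M" and t': "sum_of_squares t'" and st': "-1 = s' + (- a) * t'"
    using ex[of "- a"] a by blast
  have zero: "1 + s' + (- a) * t' = 0" "1 + s + a * t = 0"
    by (simp_all only: add.assoc st[symmetric] st'[symmetric] add.right_inverse)
  \<comment> \<open>Multiplying the two relations crosswise by \<open>t\<close> and
    \<open>t'\<close> cancels the terms in \<open>a * t * t'\<close>.\<close>
  have "t + (t' * (1 + s) + t * s') = t * (1 + s' + (- a) * t') + t' * (1 + s + a * t)"
    by (simp add: algebra_simps)
  also have "\<dots> = 0"
    by (simp only: zero mult_zero_right add_0)
  finally have "- t = t' * (1 + s) + t * s'"
    by (rule minus_unique)
  moreover have "1 + s \<in> M"
    using M(1) s by (simp add: quadratic_module_def)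
  ultimately have neg_t: "- t \<in> M"
    using quadratic_module_add[OF M(1) quadratic_module_mult_sum_of_squares[OF M(1) t']
        quadratic_module_mult_sum_of_squares[OF M(1) t s']]
    by metis
  have "t \<in> M"
    by (rule quadratic_module_sum_of_squares[OF M(1) t])
  \<comment> \<open>Since \<open>t\<close> and \<open>- t\<close> both lie in \<open>M\<close>,
    polarization gives \<open>a * t\<close> in \<open>M\<close>, and then -1 is a sum of two
    elements of \<open>M\<close>.\<close>
  have "a * t = c (1/2) ^ 2 * ((a + 1) ^ 2 * t) + c (1/2) ^ 2 * ((a - 1) ^ 2 * (- t))"
    using polarize[of a t] by simp
  also have "\<dots> \<in> M"
    by (intro quadratic_module_add[OF M(1)] quadratic_module_mult_power2[OF M(1)]
        \<open>t \<in> M\<close> neg_t)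
  finally show False
    using M(2) quadratic_module_add[OF M(1) s] st by simp
qed

section \<open>Archimedean elements\<close>

definition archimedean_in :: "'a set \<Rightarrow> 'a \<Rightarrow> bool" where
  "archimedean_in M a \<longleftrightarrow> (\<exists>N>0. c N + a \<in> M \<and> c N - a \<in> M)"

text \<open>Read u \<le> v as v - u \<in> M. Archimedean elements lie between -N and N for some real
  N, infinitesimal ones between -e and e for every real e > 0.\<close>

definition infinitesimal_in :: "'a set \<Rightarrow> 'a \<Rightarrow> bool" where
  "infinitesimal_in M a \<longleftrightarrow> (\<forall>e>0. c e + a \<in> M \<and> c e - a \<in> M)"

context
  fixes M :: "'a set"
  assumes M: "quadratic_module M"
begin

lemma archimedean_in_mono:
  assumes "c N + a \<in> M" "N \<le> K"
  shows "c K + a \<in> M"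
proof -
  have eq: "c K + a = c (K - N) + (c N + a)"
    by (simp add: diff)
  show ?thesis
    unfolding eq using assms(2)
    by (intro quadratic_module_add[OF M _ assms(1)] nonneg_in_quadratic_module[OF M]) simp
qed

lemma archimedean_in_of_real: "archimedean_in M (c r)"
  unfolding archimedean_in_def
  using nonneg_in_quadratic_module[OF M, of "\<bar>r\<bar> + 1 + r"]
    nonneg_in_quadratic_module[OF M, of "\<bar>r\<bar> + 1 - r"]
  by (intro exI[of _ "\<bar>r\<bar> + 1"]) (simp add: add diff)

lemma archimedean_in_minus: "archimedean_in M a \<Longrightarrow> archimedean_in M (- a)"
  unfolding archimedean_in_def by auto

lemma archimedean_in_add:
  assumes "archimedean_in M a" "archimedean_in M b"
  shows "archimedean_in M (a + b)"
proof -
  obtain N K where "N > 0" "c N + a \<in> M" "c N - a \<in> M" "K > 0" "c K + b \<in> M" "c K - b \<in> M"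
    using assms unfolding archimedean_in_def by blast
  then have "N + K > 0" "(c N + a) + (c K + b) \<in> M" "(c N - a) + (c K - b) \<in> M"
    by (auto intro: quadratic_module_add[OF M])
  moreover have "(c N + a) + (c K + b) = c (N + K) + (a + b)"
    "(c N - a) + (c K - b) = c (N + K) - (a + b)"
    by (simp_all add: add algebra_simps)
  ultimately show ?thesis
    unfolding archimedean_in_def by metis
qed

lemma archimedean_in_power2:
  assumes "archimedean_in M a"
  shows "archimedean_in M (a ^ 2)"
proof -
  obtain N where N: "N > 0" "c N + a \<in> M" "c N - a \<in> M"
    using assms unfolding archimedean_in_def by blast
  have two: "c 2 = 1 + 1"
    using add[of 1 1] one by simp
  \<comment> \<open>The product (N - a)(N + a) of two elements of \<open>M\<close> need not lie in
    \<open>M\<close>. Multiplied by 2N = (N + a) + (N - a), it becomes a sum of squares times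
    elements of \<open>M\<close>.\<close>
  have eq: "c (N * N) - a ^ 2 =
      c (1 / (2 * N)) * ((c N + a) ^ 2 * (c N - a) + (c N - a) ^ 2 * (c N + a))"
  proof -
    have "c (1 / (2 * N)) * (c 2 * c N) = 1"
      using mult[of "1 / (2 * N)" "2 * N"] mult[of 2 N] one N(1) by simp
    moreover have "(c N + a) ^ 2 * (c N - a) + (c N - a) ^ 2 * (c N + a) =
        (c 2 * c N) * (c (N * N) - a ^ 2)"
      by (simp add: two mult algebra_simps power2_eq_square)
    ultimately show ?thesis
      by (metis mult.assoc mult_1)
  qed
  have "c (N * N) - a ^ 2 \<in> M"
    unfolding eq using N(1)
    by (intro mult_nonneg_in_quadratic_module[OF M] quadratic_module_add[OF M]
        quadratic_module_mult_power2[OF M N(2)] quadratic_module_mult_power2[OF M N(3)]) simp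
  moreover have "c (N * N) + a ^ 2 \<in> M"
    by (intro quadratic_module_add M nonneg_in_quadratic_module quadratic_module_power2) simp
  ultimately show ?thesis
    unfolding archimedean_in_def using N(1) by (intro exI[of _ "N * N"]) simp
qed

lemma archimedean_in_scale:
  assumes "archimedean_in M a" "0 \<le> r"
  shows "archimedean_in M (c r * a)"
proof -
  obtain N where N: "N > 0" "c N + a \<in> M" "c N - a \<in> M"
    using assms unfolding archimedean_in_def by blast
  have "c (r * N) + c r * a \<in> M" "c (r * N) - c r * a \<in> M"
    using mult_nonneg_in_quadratic_module[OF M assms(2) N(2)]
      mult_nonneg_in_quadratic_module[OF M assms(2) N(3)]
    by (simp_all add: mult algebra_simps)
  \<comment> \<open>The bound \<open>r * N\<close> may be 0, while a positive one is required; hence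
    the added 1.\<close>
  moreover have "r * N \<le> r * N + 1" "0 < r * N + 1"
    using N(1) assms(2) by (auto intro: add_nonneg_pos)
  ultimately show ?thesis
    unfolding archimedean_in_def
    using archimedean_in_mono[of "r * N" "c r * a" "r * N + 1"]
      archimedean_in_mono[of "r * N" "- (c r * a)" "r * N + 1"]
    by (intro exI[of _ "r * N + 1"]) simp
qed

text \<open>Closure under squares suffices, because 4ab = (a + b)^2 - (a - b)^2.\<close>

lemma archimedean_in_mult:
  assumes "archimedean_in M a" "archimedean_in M b"
  shows "archimedean_in M (a * b)"
proof -
  have h: "c (1/4) + c (1/4) + c (1/4) + c (1/4) = 1"
    using add[of "1/4" "1/4"] add[of "1/2" "1/2"] one by (simp add: add.assoc)
  have "c (1/4) * (a + b) ^ 2 + - (c (1/4) * (a + - b) ^ 2)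
      = (c (1/4) + c (1/4) + c (1/4) + c (1/4)) * (a * b)"
    by (simp add: algebra_simps power2_eq_square)
  then have "a * b = c (1/4) * (a + b) ^ 2 + - (c (1/4) * (a + - b) ^ 2)"
    by (simp only: h mult_1_left)
  also have "archimedean_in M \<dots>"
    by (intro archimedean_in_add archimedean_in_minus archimedean_in_scale archimedean_in_power2
        assms) auto
  finally show ?thesis .
qed

text \<open>For b = a or b = -a, the element r + 1 + 2b equals (r - a^2) + (b + 1)^2; halving gives
  the bound (r + 1)/2. This is how a bound on the square of a variable bounds the variable.\<close>

lemma archimedean_in_of_power2:
  assumes "c r - a ^ 2 \<in> M" "0 \<le> r"
  shows "archimedean_in M a"
proof -
  have half: "c (1/2) + c (1/2) = 1"
    using add[of "1/2" "1/2"] one by simp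
  have "c ((r + 1) / 2) + b \<in> M" if "b = a \<or> b = - a" for b
  proof -
    have "c ((r + 1) / 2) + b = c (1/2) * (c (r + 1)) + (c (1/2) + c (1/2)) * b"
      by (simp add: mult[symmetric] half)
    also have "\<dots> = c (1/2) * ((c r - a ^ 2) + (b + 1) ^ 2)"
      using that by (auto simp: add one algebra_simps power2_eq_square)
    also have "\<dots> \<in> M"
      by (intro mult_nonneg_in_quadratic_module quadratic_module_add quadratic_module_power2
          M assms(1)) simp
    finally show ?thesis .
  qed
  from this[of a] this[of "- a"] show ?thesis
    unfolding archimedean_in_def using assms(2) by (intro exI[of _ "(r + 1) / 2"]) simp
qed

section \<open>Infinitesimal elements and standard parts\<close>

lemma infinitesimal_in_minus: "infinitesimal_in M a \<Longrightarrow> infinitesimal_in M (- a)"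
  unfolding infinitesimal_in_def by auto

lemma infinitesimal_in_add:
  assumes "infinitesimal_in M a" "infinitesimal_in M b"
  shows "infinitesimal_in M (a + b)"
  unfolding infinitesimal_in_def
proof (intro allI impI)
  fix e :: real assume "e > 0"
  then have "e / 2 > 0"
    by simp
  then have "c (e/2) + a \<in> M" "c (e/2) - a \<in> M" "c (e/2) + b \<in> M" "c (e/2) - b \<in> M"
    using assms unfolding infinitesimal_in_def by blast+
  then have "(c (e/2) + a) + (c (e/2) + b) \<in> M" "(c (e/2) - a) + (c (e/2) - b) \<in> M"
    by (blast intro: quadratic_module_add[OF M])+
  moreover have "c e = c (e/2) + c (e/2)"
    by (simp flip: add)
  ultimately show "c e + (a + b) \<in> M \<and> c e - (a + b) \<in> M"
    by (simp add: algebra_simps)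
qed

lemma infinitesimal_in_mult_power2:
  assumes "infinitesimal_in M a" "archimedean_in M b"
  shows "infinitesimal_in M (b ^ 2 * a)"
  unfolding infinitesimal_in_def
proof (intro allI impI)
  fix e :: real assume e: "e > 0"
  obtain N where N: "N > 0" "c N - b ^ 2 \<in> M"
    using archimedean_in_power2[OF assms(2)] unfolding archimedean_in_def by blast
  have "c e = c (e / N) * c N"
    using N(1) by (simp flip: mult)
  \<comment> \<open>As b^2 is at most N, a tolerance e/N on x becomes a tolerance e on b^2 x. The
    identity is needed for \<open>a\<close> and for \<open>- a\<close>.\<close>
  then have eq: "c e + b ^ 2 * x = c (e / N) * (c N - b ^ 2) + b ^ 2 * (c (e / N) + x)" for x
    by (simp add: algebra_simps)
  have "c e + b ^ 2 * x \<in> M" if "c (e / N) + x \<in> M" for x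
    unfolding eq using N(1) e
    by (intro quadratic_module_add[OF M] mult_nonneg_in_quadratic_module[OF M _ N(2)]
        quadratic_module_mult_power2[OF M that]) simp
  from this[of a] this[of "- a"] show "c e + b ^ 2 * a \<in> M \<and> c e - b ^ 2 * a \<in> M"
    using assms(1) N(1) e by (simp add: infinitesimal_in_def)
qed

text \<open>Polarization reduces the factor \<open>b\<close> to squares of Archimedean elements.
  When every element is Archimedean, the infinitesimals therefore form an ideal.\<close>

lemma infinitesimal_in_mult:
  assumes "infinitesimal_in M a" "archimedean_in M b"
  shows "infinitesimal_in M (b * a)"
proof -
  have "archimedean_in M (b + 1)" "archimedean_in M (b - 1)"
    using archimedean_in_add[OF assms(2) archimedean_in_of_real[of 1]]
      archimedean_in_add[OF assms(2) archimedean_in_of_real[of "-1"]]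
    by (simp_all add: one minus)
  moreover have "b * a = c (1/2) ^ 2 * ((b + 1) ^ 2 * a) + - (c (1/2) ^ 2 * ((b - 1) ^ 2 * a))"
    using polarize[of b a] by simp
  ultimately show ?thesis
    by (simp only: infinitesimal_in_add infinitesimal_in_minus infinitesimal_in_mult_power2
        archimedean_in_of_real assms)
qed

lemma infinitesimal_in_of_real_iff:
  assumes "-1 \<notin> M"
  shows "infinitesimal_in M (c r) \<longleftrightarrow> r = 0"
proof
  assume inf: "infinitesimal_in M (c r)"
  show "r = 0"
  proof (rule ccontr)
    assume r: "r \<noteq> 0"
    \<comment> \<open>Tolerance \<bar>r\<bar>/2 is violated by \<open>r\<close>: one of the two
      reals is -\<bar>r\<bar>/2, which rescales to -1.\<close>
    have *: "c (\<bar>r\<bar> / 2 + r) \<in> M" "c (\<bar>r\<bar> / 2 - r) \<in> M"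
      using inf r by (auto simp: infinitesimal_in_def add diff)
    then have "c (- \<bar>r\<bar> / 2) \<in> M"
      by (cases "r > 0") auto
    then have "c (2 / \<bar>r\<bar>) * c (- \<bar>r\<bar> / 2) \<in> M"
      by (intro mult_nonneg_in_quadratic_module M) auto
    moreover have "c (2 / \<bar>r\<bar>) * c (- \<bar>r\<bar> / 2) = -1"
      using r by (simp add: minus one flip: mult)
    ultimately show False
      using assms by simp
  qed
next
  assume "r = 0"
  then show "infinitesimal_in M (c r)"
    using nonneg_in_quadratic_module[OF M] by (auto simp: infinitesimal_in_def zero)
qed

text \<open>A Dedekind cut: the standard part is the supremum of the reals below \<open>a\<close>.
  The Archimedean bound makes this set nonempty and bounded; totality gives the upper estimate for
  \<open>a\<close>.\<close>

lemma standard_part_exists: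
  assumes proper: "-1 \<notin> M" and total: "\<And>a. a \<in> M \<or> - a \<in> M" and arch: "archimedean_in M a"
  shows "\<exists>r. infinitesimal_in M (a - c r)"
proof -
  let ?L = "{r. a - c r \<in> M}"
  obtain N where N: "N > 0" "c N + a \<in> M" "c N - a \<in> M"
    using arch unfolding archimedean_in_def by blast
  have "- N \<in> ?L"
    using N(2) by (simp add: minus add.commute)
  have below: "r \<le> N" if "a - c r \<in> M" for r
  proof (rule ccontr)
    assume "\<not> r \<le> N"
    \<comment> \<open>If r > N, adding the two bounds puts the negative real N - r into
      \<open>M\<close>, and the positive factor 1/(r - N) turns it into -1.\<close>
    then have "c (1 / (r - N)) * ((a - c r) + (c N - a)) \<in> M"
      using that N by (intro mult_nonneg_in_quadratic_module quadratic_module_add M) auto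
    moreover have "(a - c r) + (c N - a) = c (N - r)"
      by (simp add: diff)
    moreover have "1 / (r - N) * (N - r) = -1"
      using \<open>\<not> r \<le> N\<close> by (simp add: divide_eq_eq)
    then have "c (1 / (r - N)) * c (N - r) = c (-1)"
      by (metis mult)
    ultimately show False
      using proper by (simp add: minus one)
  qed
  then have bdd: "bdd_above ?L"
    by (intro bdd_aboveI[of _ N]) auto
  define s where "s = Sup ?L"
  have "infinitesimal_in M (a - c s)"
    unfolding infinitesimal_in_def
  proof (intro allI impI conjI)
    fix e :: real assume e: "e > 0"
    then obtain r where r: "a - c r \<in> M" "s - e < r"
      using less_cSupD[of ?L "s - e"] \<open>- N \<in> ?L\<close> unfolding s_def by auto
    then have "c (r - (s - e)) + (a - c r) \<in> M"
      by (intro quadratic_module_add[OF M] nonneg_in_quadratic_module[OF M]) auto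
    then show "c e + (a - c s) \<in> M"
      by (simp add: add diff algebra_simps)
    \<comment> \<open>A real above the supremum is not below \<open>a\<close>, so totality yields
      the opposite sign.\<close>
    have "s + e \<notin> ?L"
      using cSup_upper[OF _ bdd, of "s + e"] e unfolding s_def by linarith
    then have "- (a - c (s + e)) \<in> M"
      using total by blast
    then show "c e - (a - c s) \<in> M"
      by (simp add: add algebra_simps)
  qed
  then show ?thesis ..
qed

end

end

section \<open>Evaluation of polynomials\<close>

interpretation Const: real_coefficients "Const :: real \<Rightarrow> ('v, real) mpoly"
  by unfold_locales (simp_all add: Const_def single_add mult_single)

lemma Const_0: "Const 0 = 0"
  by (simp add: Const_def)

lemma eval_0: "eval 0 x = 0"
  by (simp add: eval_def subst_def)

lemma eval_single:
  "eval (Poly_Mapping.single m a) x =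
    a * (\<Prod>v\<in>Poly_Mapping.keys m. x v ^ Poly_Mapping.lookup m v)"
  by (simp add: eval_def subst_def)

lemma eval_Const: "eval (Const a) x = a"
  by (simp add: Const_def eval_single)

lemma eval_1: "eval 1 x = 1"
  using eval_Const[of 1 x] by (simp add: Const_def)

lemma eval_Var: "eval (Var v) x = x v"
  by (simp add: Var_def eval_single)

lemma eval_add: "eval (p + q) x = eval p x + eval q x"
  unfolding eval_def subst_def
  by (rule setsum_keys_plus_distrib) (simp_all add: distrib_right)

lemma eval_minus: "eval (- p) x = - eval p x" for p :: "('v, 'a::comm_ring_1) mpoly"
  using eval_add[of p "- p" x] by (simp add: eval_0 eq_neg_iff_add_eq_0 add.commute)

lemma eval_diff: "eval (p - q) x = eval p x - eval q x" for p :: "('v, 'a::comm_ring_1) mpoly"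
  using eval_add[of p "- q" x] by (simp add: eval_minus)

lemma eval_sum: "eval (\<Sum>i\<in>A. p i) x = (\<Sum>i\<in>A. eval (p i) x)"
  by (induction A rule: infinite_finite_induct) (simp_all add: eval_0 eval_add)

lemma prod_power_lookup_add:
  fixes x :: "'v \<Rightarrow> 'a::comm_semiring_1"
  shows "(\<Prod>v\<in>Poly_Mapping.keys (k + m). x v ^ Poly_Mapping.lookup (k + m) v) =
    (\<Prod>v\<in>Poly_Mapping.keys k. x v ^ Poly_Mapping.lookup k v) *
    (\<Prod>v\<in>Poly_Mapping.keys m. x v ^ Poly_Mapping.lookup m v)"
proof -
  let ?S = "Poly_Mapping.keys k \<union> Poly_Mapping.keys m"
  \<comment> \<open>All products are taken over one common index set; the added factors have
    exponent 0.\<close>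
  have *: "(\<Prod>v\<in>Poly_Mapping.keys l. x v ^ Poly_Mapping.lookup l v) =
      (\<Prod>v\<in>?S. x v ^ Poly_Mapping.lookup l v)" if "Poly_Mapping.keys l \<subseteq> ?S" for l
    using that by (intro prod.mono_neutral_left) (auto simp: in_keys_iff)
  show ?thesis
    unfolding *[OF keys_add] *[OF Un_upper1] *[OF Un_upper2]
    by (simp only: lookup_add power_add prod.distrib)
qed

lemma poly_mapping_eq_sum_single:
  "p = (\<Sum>m\<in>Poly_Mapping.keys p. Poly_Mapping.single m (Poly_Mapping.lookup p m))"
  by (rule poly_mapping_eqI)
    (auto simp: lookup_sum lookup_single when_def in_keys_iff)

text \<open>Both sides are biadditive, so expanding \<open>p\<close> and \<open>q\<close> into terms
  leaves products of two terms, where exponents add.\<close>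

lemma eval_mult:
  fixes p q :: "('v, 'a::comm_semiring_1) mpoly"
  shows "eval (p * q) x = eval p x * eval q x"
proof -
  have single: "eval (Poly_Mapping.single k a * Poly_Mapping.single m b) x =
      eval (Poly_Mapping.single k a) x * eval (Poly_Mapping.single m b) x" for k m and a b :: 'a
    by (simp add: mult_single eval_single prod_power_lookup_add algebra_simps)
  show ?thesis
    by (subst (1 2) poly_mapping_eq_sum_single[of p],
        subst (1 2) poly_mapping_eq_sum_single[of q])
      (simp add: sum_product eval_sum single)
qed

lemma eval_power: "eval (p ^ n) x = eval p x ^ n"
  by (induction n) (simp_all add: eval_1 eval_mult)

lemma eval_prod: "eval (\<Prod>i\<in>A. p i) x = (\<Prod>i\<in>A. eval (p i) x)"
  by (induction A rule: infinite_finite_induct) (simp_all add: eval_1 eval_mult)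

lemma eval_sum_of_squares_nonneg:
  fixes p :: "('v, real) mpoly"
  assumes "sum_of_squares p"
  shows "0 \<le> eval p x"
  using assms by (auto simp: sum_of_squares_def eval_sum eval_power intro!: sum_nonneg)

lemma eval_span_eq_0:
  fixes x :: "'v \<Rightarrow> 'a::comm_ring_1"
  assumes "p \<in> ideal.span S" and "\<And>q. q \<in> S \<Longrightarrow> eval q x = 0"
  shows "eval p x = 0"
  using assms(1)
  by (induction rule: ideal.span_induct_alt) (simp_all add: eval_0 eval_add eval_mult assms(2))

text \<open>Constants and variables generate the polynomial ring: each term is a constant times
  powers of variables, and each polynomial is a finite sum of terms.\<close>

lemma mpoly_induct [case_names Const Var add mult]:
  fixes p :: "('v, 'a::comm_semiring_1) mpoly"
  assumes Const: "\<And>a. P (Const a)" and Var: "\<And>v. P (Var v)"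
    and add: "\<And>p q. P p \<Longrightarrow> P q \<Longrightarrow> P (p + q)"
    and mult: "\<And>p q. P p \<Longrightarrow> P q \<Longrightarrow> P (p * q)"
  shows "P p"
proof -
  have P_0: "P 0" and P_1: "P 1"
    using Const[of 0] Const[of 1] by (simp_all add: Const_def)
  have P_power: "P (q ^ n)" if "P q" for q n
    by (induction n) (use that P_1 mult in auto)
  have P_prod: "P (\<Prod>i\<in>A. q i)" if "\<And>i. P (q i)" for A :: "'v set" and q
    by (induction A rule: infinite_finite_induct) (use that P_1 mult in auto)
  have P_sum: "P (\<Sum>i\<in>A. q i)" if "\<And>i. P (q i)" for A :: "('v \<Rightarrow>\<^sub>0 nat) set" and q
    by (induction A rule: infinite_finite_induct) (use that P_0 add in auto)
  have Var_power: "Var v ^ n = Poly_Mapping.single (Poly_Mapping.single v n) (1::'a)"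
    for v :: 'v and n
    by (induction n) (simp_all add: Var_def mult_single flip: single_add)
  have prod_single: "(\<Prod>v\<in>A. Poly_Mapping.single (k v) 1) =
      Poly_Mapping.single (\<Sum>v\<in>A. k v) (1::'a)" for A and k :: "'v \<Rightarrow> 'v \<Rightarrow>\<^sub>0 nat"
    by (induction A rule: infinite_finite_induct) (simp_all add: mult_single)
  have "Poly_Mapping.single m a =
      Const a * (\<Prod>v\<in>Poly_Mapping.keys m. Var v ^ Poly_Mapping.lookup m v)"
    for m :: "'v \<Rightarrow>\<^sub>0 nat" and a :: 'a
    using poly_mapping_eq_sum_single[of m]
    by (simp add: Var_power prod_single Const_def mult_single)
  then have "P (Poly_Mapping.single m a)" for m a
    by (simp add: Const mult P_prod P_power Var)
  then show ?thesis
    by (subst poly_mapping_eq_sum_single) (rule P_sum)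
qed

section \<open>Real and imaginary parts\<close>

lemma eval_XiY: "eval (XiY f) w = eval f (\<lambda>k. w (Inl k) + \<i> * w (Inr k))"
  by (simp add: XiY_def subst_def eval_sum eval_mult eval_prod eval_power eval_add eval_Const
      eval_Var eval_def[of f])

lemma eval_map_complex_of_real:
  "eval (Poly_Mapping.map complex_of_real p) (\<lambda>v. complex_of_real (x v)) =
    complex_of_real (eval p x)"
proof -
  \<comment> \<open>The embedding of the reals sends only 0 to 0, so both evaluations sum over the
    same monomials.\<close>
  have "Poly_Mapping.keys (Poly_Mapping.map complex_of_real p) = Poly_Mapping.keys p"
    by (auto simp: in_keys_iff map.rep_eq when_def)
  then show ?thesis
    by (simp add: eval_def subst_def map.rep_eq when_def in_keys_iff)
qed

text \<open>At a real point \<open>w\<close> both parts take real values, so the decomposition of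
  \<open>XiY f\<close> splits the value of \<open>f\<close>. Complex zeros of \<open>f\<close> thus
  become common real zeros of its two parts.\<close>

lemma eval_re_im_part:
  "eval f (\<lambda>k. Complex (w (Inl k)) (w (Inr k))) =
    Complex (eval (re_part f) w) (eval (im_part f) w)"
proof -
  have "eval f (\<lambda>k. Complex (w (Inl k)) (w (Inr k))) = eval (XiY f) (\<lambda>v. complex_of_real (w v))"
    by (simp add: eval_XiY Complex_eq)
  also have "\<dots> = complex_of_real (eval (re_part f) w) + \<i> * complex_of_real (eval (im_part f) w)"
    by (simp add: XiY_eq eval_add eval_mult eval_Const eval_map_complex_of_real)
  finally show ?thesis
    by (simp add: Complex_eq)
qed

lemma complex_variety_span:
  "complex_variety (ideal.span S) = {z. \<forall>f\<in>S. eval f (\<lambda>k. z $ k) = 0}"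
  unfolding complex_variety_def by (auto intro: ideal.span_base eval_span_eq_0)

lemma mem_unlog_amoeba_span_iff:
  fixes F :: "('n::finite, complex) mpoly set"
  assumes pos: "\<And>k. 0 < lam $ k"
  shows "lam \<in> unlog_amoeba (ideal.span F) \<longleftrightarrow>
    (\<exists>w. (\<forall>f\<in>F. eval (re_part f) w = 0 \<and> eval (im_part f) w = 0) \<and>
      (\<forall>k. w (Inl k) ^ 2 + w (Inr k) ^ 2 = (lam $ k) ^ 2))"
    (is "_ \<longleftrightarrow> ?R")
proof
  assume "lam \<in> unlog_amoeba (ideal.span F)"
  then obtain z where z: "\<forall>f\<in>F. eval f (\<lambda>k. z $ k) = 0" and lam: "\<And>k. lam $ k = cmod (z $ k)"
    unfolding unlog_amoeba_def complex_variety_span by auto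
  let ?w = "case_sum (\<lambda>k. Re (z $ k)) (\<lambda>k. Im (z $ k))"
  have "eval (re_part f) ?w = 0 \<and> eval (im_part f) ?w = 0" if "f \<in> F" for f
    using z that eval_re_im_part[of f ?w] by (simp add: complex_eq_iff)
  then show ?R
    by (intro exI[of _ ?w]) (simp add: lam cmod_power2)
next
  assume ?R
  then obtain w where w: "\<forall>f\<in>F. eval (re_part f) w = 0 \<and> eval (im_part f) w = 0"
    and lam: "\<And>k. w (Inl k) ^ 2 + w (Inr k) ^ 2 = (lam $ k) ^ 2" by blast
  let ?z = "\<chi> k. Complex (w (Inl k)) (w (Inr k))"
  have "eval f (\<lambda>k. ?z $ k) = 0" if "f \<in> F" for f
  proof -
    have "eval f (\<lambda>k. ?z $ k) = eval f (\<lambda>k. Complex (w (Inl k)) (w (Inr k)))"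
      by (rule arg_cong[of _ _ "eval f"]) (simp add: fun_eq_iff)
    also have "\<dots> = 0"
      using w that by (simp add: eval_re_im_part complex_eq_iff)
    finally show ?thesis .
  qed
  then have "?z \<in> complex_variety (ideal.span F)"
    unfolding complex_variety_span by blast
  \<comment> \<open>The modulus is the square root of (lam $ k)^2, and positivity selects the root
    \<open>lam $ k\<close>.\<close>
  moreover have "lam = (\<chi> k. cmod (?z $ k))"
    using pos by (simp add: vec_eq_iff cmod_def lam less_imp_le)
  ultimately show "lam \<in> unlog_amoeba (ideal.span F)"
    unfolding unlog_amoeba_def by blast
qed

section \<open>The compact real Nullstellensatz\<close>

text \<open>The assumption \<open>bounded\<close> is the Archimedean condition on the variables; the
  zero is assembled from their standard parts with respect to a maximal module.\<close>

lemma real_zero_exists: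
  fixes S :: "('v, real) mpoly set"
  assumes no_certificate: "\<not> (\<exists>G\<in>ideal.span S. \<exists>H. sum_of_squares H \<and> G + H + 1 = 0)"
    and bounded: "\<And>v. \<exists>r\<ge>0. \<exists>G\<in>ideal.span S. \<exists>H. sum_of_squares H \<and> Const r - Var v ^ 2 = G + H"
  shows "\<exists>x. \<forall>p\<in>S. eval p x = 0"
proof -
  let ?M = "{g + h |g h. g \<in> ideal.span S \<and> sum_of_squares h}"
  have "-1 \<notin> ?M"
  proof
    assume "-1 \<in> ?M"
    then obtain G H where "G \<in> ideal.span S" "sum_of_squares H" "-1 = G + H"
      by blast
    moreover from this have "G + H + 1 = 0"
      by (metis add.left_inverse)
    ultimately show False
      using no_certificate by blast
  qed
  then obtain M where sub: "?M \<subseteq> M" and M: "quadratic_module M" and proper: "-1 \<notin> M"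
    and max: "\<And>M'. quadratic_module M' \<Longrightarrow> -1 \<notin> M' \<Longrightarrow> M \<subseteq> M' \<Longrightarrow> M' = M"
    by (rule maximal_quadratic_module_exists[OF quadratic_module_ideal_plus_squares]) (rule that)
  have in_M: "G + H \<in> M" if "G \<in> ideal.span S" "sum_of_squares H" for G H
    using sub that by blast
  have total: "a \<in> M \<or> - a \<in> M" for a
    using Const.maximal_quadratic_module_total[OF M proper max] .
  have arch: "Const.archimedean_in M p" for p
  proof (induction p rule: mpoly_induct)
    case (Const r)
    then show ?case by (rule Const.archimedean_in_of_real[OF M])
  next
    case (Var v)
    obtain r where "r \<ge> 0" "Const r - Var v ^ 2 \<in> M"
      using bounded[of v] in_M by metis
    then show ?case
      by (intro Const.archimedean_in_of_power2[OF M])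
  qed (simp_all add: Const.archimedean_in_add[OF M] Const.archimedean_in_mult[OF M])
  have "\<exists>r. Const.infinitesimal_in M (Var v - Const r)" for v
    by (rule Const.standard_part_exists[OF M proper total arch])
  then obtain x where x: "\<And>v. Const.infinitesimal_in M (Var v - Const (x v))"
    by metis
  \<comment> \<open>Taking standard parts is a ring homomorphism, so on every polynomial it agrees
    with evaluation at \<open>x\<close>.\<close>
  have eval_inf: "Const.infinitesimal_in M (p - Const (eval p x))" for p
  proof (induction p rule: mpoly_induct)
    case (Const r)
    then show ?case
      using Const.infinitesimal_in_of_real_iff[OF M proper, of 0] by (simp add: eval_Const Const_0)
  next
    case (Var v)
    then show ?case by (simp add: eval_Var x)
  next
    case (add p q)
    then show ?case
      using Const.infinitesimal_in_add[OF M add.IH] by (simp add: eval_add Const.add algebra_simps)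
  next
    case (mult p q)
    have "p * q - Const (eval (p * q) x) =
        q * (p - Const (eval p x)) + Const (eval p x) * (q - Const (eval q x))"
      by (simp add: eval_mult Const.mult algebra_simps)
    then show ?case
      by (simp add: Const.infinitesimal_in_add[OF M] Const.infinitesimal_in_mult[OF M] arch mult.IH)
  qed
  have "eval p x = 0" if p: "p \<in> S" for p
  proof -
    \<comment> \<open>The ideal contains \<open>p\<close> and \<open>- p\<close>, so
      \<open>p\<close> is infinitesimal. Its value at \<open>x\<close> is then an infinitesimal
      real, hence 0.\<close>
    have "p \<in> M" "- p \<in> M"
      using in_M[OF ideal.span_base[OF p] sum_of_squares_0]
        in_M[OF ideal.span_neg[OF ideal.span_base[OF p]] sum_of_squares_0] by simp_all
    then have "Const.infinitesimal_in M p"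
      using quadratic_module_add[OF M Const.nonneg_in_quadratic_module[OF M], of _ p]
        quadratic_module_add[OF M Const.nonneg_in_quadratic_module[OF M], of _ "- p"]
      by (simp add: Const.infinitesimal_in_def)
    then have "Const.infinitesimal_in M (p + - (p - Const (eval p x)))"
      by (intro Const.infinitesimal_in_add Const.infinitesimal_in_minus M eval_inf)
    then show ?thesis
      using Const.infinitesimal_in_of_real_iff[OF M proper] by simp
  qed
  then show ?thesis by blast
qed

theorem corollary3p2:
  fixes r :: nat
    and f :: "nat \<Rightarrow> ('n::finite, complex) mpoly"
    and I :: "('n, complex) mpoly set"
    and I' :: "('n + 'n, real) mpoly set"
    and lam :: "real ^ 'n"
  assumes I: "I = ideal.span (f ` {1..r})"
    and pos: "\<And>k. 0 < lam $ k"
    and I': "I' = ideal.span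
      ((\<Union>j\<in>{1..r}. {re_part (f j), im_part (f j)})
       \<union> {Var (Inl k) ^ 2 + Var (Inr k) ^ 2 - Const ((lam $ k) ^ 2) | k. True})"
  shows "(lam \<in> unlog_amoeba I \<or> (\<exists>G\<in>I'. \<exists>H :: ('n + 'n, real) mpoly. sum_of_squares H \<and> G + H + 1 = 0))
    \<and> \<not> (lam \<in> unlog_amoeba I \<and> (\<exists>G\<in>I'. \<exists>H :: ('n + 'n, real) mpoly. sum_of_squares H \<and> G + H + 1 = 0))"
proof -
  let ?S = "(\<Union>j\<in>{1..r}. {re_part (f j), im_part (f j)})
       \<union> {Var (Inl k) ^ 2 + Var (Inr k) ^ 2 - Const ((lam $ k) ^ 2) | k. True}"
  have zero_iff: "(\<forall>p\<in>?S. eval p w = 0) \<longleftrightarrow>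
      (\<forall>g\<in>f ` {1..r}. eval (re_part g) w = 0 \<and> eval (im_part g) w = 0) \<and>
      (\<forall>k. w (Inl k) ^ 2 + w (Inr k) ^ 2 = (lam $ k) ^ 2)" for w
  proof -
    have "(\<forall>p\<in>?S. eval p w = 0) \<longleftrightarrow>
        (\<forall>g\<in>f ` {1..r}. eval (re_part g) w = 0 \<and> eval (im_part g) w = 0) \<and>
        (\<forall>k. eval (Var (Inl k) ^ 2 + Var (Inr k) ^ 2 - Const ((lam $ k) ^ 2)) w = 0)"
      by blast
    then show ?thesis
      by (simp add: eval_add eval_diff eval_power eval_Var eval_Const)
  qed
  have amoeba: "lam \<in> unlog_amoeba I \<longleftrightarrow> (\<exists>w. \<forall>p\<in>?S. eval p w = 0)"
    unfolding I mem_unlog_amoeba_span_iff[OF pos] zero_iff ..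
  have bounded: "\<exists>r\<ge>0. \<exists>G\<in>ideal.span ?S. \<exists>H. sum_of_squares H \<and> Const r - Var v ^ 2 = G + H" for v
  proof -
    \<comment> \<open>For a variable of index k, \<open>u\<close> is its partner in the pair X_k,
      Y_k: moving the partner's square to the other side of the circle equation supplies the sum of
      squares.\<close>
    obtain k u where u: "Const ((lam $ k) ^ 2) - Var v ^ 2 =
        - (Var (Inl k) ^ 2 + Var (Inr k) ^ 2 - Const ((lam $ k) ^ 2)) + Var u ^ 2"
    proof (cases v)
      case (Inl k)
      then show thesis
        by (intro that[of k "Inr k"]) simp
    next
      case (Inr k)
      then show thesis
        by (intro that[of k "Inl k"]) simp
    qed
    have "- (Var (Inl k) ^ 2 + Var (Inr k) ^ 2 - Const ((lam $ k) ^ 2)) \<in> ideal.span ?S"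
      by (intro ideal.span_neg ideal.span_base) blast
    then show ?thesis
      using u sum_of_squares_power2[of "Var u"] zero_le_power2[of "lam $ k"] by blast
  qed
  \<comment> \<open>The alternatives exclude each other: at a common real zero \<open>G\<close>
    vanishes and \<open>H\<close> is nonnegative, so \<open>G + H + 1\<close> is at least 1.\<close>
  have "\<not> (\<exists>G\<in>I'. \<exists>H. sum_of_squares H \<and> G + H + 1 = 0)" if w: "\<forall>p\<in>?S. eval p w = 0" for w
  proof
    assume "\<exists>G\<in>I'. \<exists>H. sum_of_squares H \<and> G + H + 1 = 0"
    then obtain G H where G: "G \<in> ideal.span ?S" and H: "sum_of_squares H" and "G + H + 1 = 0"
      unfolding I' by blast
    then have "eval G w + eval H w + 1 = 0"
      by (metis eval_0 eval_1 eval_add)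
    moreover have "eval G w = 0"
      using eval_span_eq_0[OF G] w by blast
    ultimately show False
      using eval_sum_of_squares_nonneg[OF H, of w] by simp
  qed
  then show ?thesis
    unfolding amoeba using real_zero_exists[OF _ bounded] I' by blast
qed

end
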